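(* Let $s,t\ge 1$ be integers. If $m=2^{\ell}$ for some integer $\ell\ge 1$, then the complete multipartite graph $K_{s,t,s,t,\dots,s,t}$ with $m$ parts ($m/2$ parts of size $s$ and $m/2$ parts of size $t$) is interval colorable.
   Context: Graphs are finite and simple. An edge coloring assigns a color (a natural number) to each edge; it is proper if edges sharing an endpoint receive different colors. A graph $G$ is interval colorable if it has a proper edge coloring such that, for every vertex $v$, the set of colors on the edges incident with $v$ is a set of consecutive integers (an integral interval). Parts of a complete multipartite graph are its maximal independent sets: vertices in the same part are non-adjacent and any two vertices in different parts are adjacent. *)

theory Defs
  imports "Graph_Theory.Digraph" "HOL-Library.Disjoint_Sets"
begin

text \<open>
  A finite simple graph is a \<^locale>\<open>graph\<close>, i.e. a finite loop-free symmetric digraph without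
  parallel arcs. Colorings live on undirected edges, so the two opposite arcs that represent an
  edge are identified.
\<close>

definition edges :: "('a, 'b) pre_digraph \<Rightarrow> 'a set set" where
  "edges G = {{u, v} | u v. (u, v) \<in> arcs_ends G}"

definition incident_edges :: "('a, 'b) pre_digraph \<Rightarrow> 'a \<Rightarrow> 'a set set" where
  "incident_edges G v = {e \<in> edges G. v \<in> e}"

definition proper_edge_coloring :: "('a, 'b) pre_digraph \<Rightarrow> ('a set \<Rightarrow> nat) \<Rightarrow> bool" where
  "proper_edge_coloring G c \<longleftrightarrow>
     (\<forall>e \<in> edges G. \<forall>f \<in> edges G. e \<noteq> f \<and> e \<inter> f \<noteq> {} \<longrightarrow> c e \<noteq> c f)"

text \<open>The interval may be empty, which covers isolated vertices.\<close>

definition interval_coloring :: "('a, 'b) pre_digraph \<Rightarrow> ('a set \<Rightarrow> nat) \<Rightarrow> bool" where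
  "interval_coloring G c \<longleftrightarrow> proper_edge_coloring G c \<and>
     (\<forall>v \<in> verts G. \<exists>a b. c ` incident_edges G v = {a..b})"

definition interval_colorable :: "('a, 'b) pre_digraph \<Rightarrow> bool" where
  "interval_colorable G \<longleftrightarrow> (\<exists>c. interval_coloring G c)"

definition multipartite_parts :: "('a, 'b) pre_digraph \<Rightarrow> 'a set set \<Rightarrow> bool" where
  "multipartite_parts G P \<longleftrightarrow> partition_on (verts G) P \<and>
     (\<forall>A \<in> P. \<forall>B \<in> P. \<forall>u \<in> A. \<forall>v \<in> B. (u, v) \<in> arcs_ends G \<longleftrightarrow> A \<noteq> B)"

text \<open>
  The predicate below determines \<open>G\<close> up to isomorphism only: it says that
  \<open>G\<close> is a copy of the complete multipartite graph whose part sizes, counted with multiplicity,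
  are listed in \<open>ns\<close>. Distinctness of \<open>Ps\<close> makes equal entries of \<open>ns\<close> belong to different parts.
\<close>

definition complete_multipartite :: "nat list \<Rightarrow> ('a, 'b) pre_digraph \<Rightarrow> bool" where
  "complete_multipartite ns G \<longleftrightarrow> graph G \<and>
     (\<exists>Ps. distinct Ps \<and> multipartite_parts G (set Ps) \<and> map card Ps = ns)"

definition independent_set :: "('a, 'b) pre_digraph \<Rightarrow> 'a set \<Rightarrow> bool" where
  "independent_set G S \<longleftrightarrow> S \<subseteq> verts G \<and> (\<forall>u \<in> S. \<forall>v \<in> S. (u, v) \<notin> arcs_ends G)"

lemma multipartite_parts_maximal_independent:
  assumes "multipartite_parts G P" and "verts G \<noteq> {}"
  shows "P = {S. independent_set G S \<and> (\<forall>T. independent_set G T \<and> S \<subseteq> T \<longrightarrow> T = S)}"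
proof -
  have un: "\<Union>P = verts G" and ne: "{} \<notin> P"
    and adj: "\<And>A B u v. A \<in> P \<Longrightarrow> B \<in> P \<Longrightarrow> u \<in> A \<Longrightarrow> v \<in> B \<Longrightarrow>
      (u, v) \<in> arcs_ends G \<longleftrightarrow> A \<noteq> B"
    using assms(1) by (auto simp: multipartite_parts_def partition_on_def)
  have part: "independent_set G A" if "A \<in> P" for A
    using that un adj by (auto simp: independent_set_def)
  have sub: "T \<subseteq> A" if "independent_set G T" "A \<in> P" "u \<in> A" "u \<in> T" for A T u
  proof
    fix v assume "v \<in> T"
    then have "v \<in> \<Union>P" using that(1) un by (auto simp: independent_set_def)
    then obtain B where "B \<in> P" "v \<in> B" by blast
    with that \<open>v \<in> T\<close> adj[of A B u v] show "v \<in> A" by (auto simp: independent_set_def)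
  qed
  show ?thesis
  proof (intro set_eqI iffI; clarsimp)
    fix S assume S: "S \<in> P"
    then obtain u where "u \<in> S" using ne by (metis ex_in_conv)
    then show "independent_set G S \<and> (\<forall>T. independent_set G T \<and> S \<subseteq> T \<longrightarrow> T = S)"
      using S part sub by blast
  next
    fix S assume S: "independent_set G S" and
      max: "\<forall>T. independent_set G T \<and> S \<subseteq> T \<longrightarrow> T = S"
    obtain A where A: "A \<in> P" "S \<subseteq> A"
    proof (cases "S = {}")
      case True
      then show ?thesis using assms(2) un that by blast
    next
      case False
      then obtain u where "u \<in> S" by blast
      moreover from this have "u \<in> \<Union>P" using S un by (auto simp: independent_set_def)
      then obtain B where "B \<in> P" "u \<in> B"
        by blast
      ultimately show ?thesis using that sub S by blast
    qed
    with part max show "S \<in> P" by blast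
  qed
qed

lemma complete_multipartite_exists:
  assumes "0 \<notin> set ns"
  shows "\<exists>G :: (nat \<times> nat, (nat \<times> nat) \<times> (nat \<times> nat)) pre_digraph. complete_multipartite ns G"
proof -
  define Q where "Q i = {i} \<times> {..<ns ! i}" for i
  define V where "V = (\<Union>i<length ns. Q i)"
  define G :: "(nat \<times> nat, (nat \<times> nat) \<times> (nat \<times> nat)) pre_digraph" where
    "G = \<lparr>verts = V, arcs = {(u, v). u \<in> V \<and> v \<in> V \<and> fst u \<noteq> fst v}, tail = fst, head = snd\<rparr>"
  have fin: "finite V" by (auto simp: V_def Q_def)
  have ae: "arcs_ends G = {(u, v). u \<in> V \<and> v \<in> V \<and> fst u \<noteq> fst v}"
    by (auto simp: G_def arcs_ends_conv)
  have "finite {(u, v). u \<in> V \<and> v \<in> V \<and> fst u \<noteq> fst v}"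
    by (rule finite_subset[of _ "V \<times> V"]) (auto simp: fin)
  moreover have "symmetric G" by (auto simp: symmetric_def ae intro!: symI)
  ultimately have gr: "graph G"
    by unfold_locales (auto simp: G_def fin arc_to_ends_def)
  have pos: "0 < ns ! i" if "i < length ns" for i
    using assms nth_mem[OF that] by (metis gr0I)
  have ne: "Q i \<noteq> {}" if "i < length ns" for i using pos[OF that] by (auto simp: Q_def)
  have inj: "inj_on Q {..<length ns}"
  proof (rule inj_onI)
    fix i j assume "i \<in> {..<length ns}" "j \<in> {..<length ns}" "Q i = Q j"
    then have "(i, 0) \<in> Q j" using pos[of i] by (auto simp: Q_def)
    then show "i = j" by (auto simp: Q_def)
  qed
  have "partition_on V (Q ` {..<length ns})"
    by (rule partition_onI) (use ne in \<open>auto simp: V_def Q_def disjnt_def\<close>)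
  moreover have "(u, v) \<in> arcs_ends G \<longleftrightarrow> Q i \<noteq> Q j"
    if "i < length ns" "j < length ns" "u \<in> Q i" "v \<in> Q j" for i j u v
  proof -
    have "u \<in> V" "v \<in> V" "fst u = i" "fst v = j" using that by (auto simp: V_def Q_def)
    then show ?thesis using that inj by (auto simp: ae dest: inj_onD)
  qed
  ultimately have "multipartite_parts G (Q ` {..<length ns})"
    by (auto simp: multipartite_parts_def G_def)
  then have "multipartite_parts G (set (map Q [0..<length ns]))" by (simp add: atLeast0LessThan)
  moreover have "distinct (map Q [0..<length ns])"
    using inj by (simp add: distinct_map atLeast0LessThan)
  moreover have "map card (map Q [0..<length ns]) = ns"
    by (rule nth_equalityI) (auto simp: Q_def card_cartesian_product)
  ultimately show ?thesis using gr unfolding complete_multipartite_def by blast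
qed

end

theory Submission
  imports Defs
begin

text \<open>
  The idea is to blow up the classical 1-factorization of the complete graph on \<open>2 ^ l\<close> vertices.
  Number the parts by \<open>0, \<dots>, 2 ^ l - 1\<close>. The edges of that complete graph split into the perfect
  matchings \<open>xor x y = z\<close> with \<open>z = 1, \<dots>, 2 ^ l - 1\<close>, so from a vertex in part \<open>x\<close> the edges can be
  arranged in consecutive blocks: block \<open>z\<close> goes to the single part \<open>xor x z\<close>.

  Number the vertices inside a part of size \<open>k\<close> by \<open>0, \<dots>, k - 1\<close>. Between two parts, the coloring
  \<open>i + j\<close> gives vertex \<open>i\<close> the interval that starts at \<open>i\<close> and has the size of the opposite part as its
  length. Hence, if block \<open>z\<close> is shifted by the total size of the blocks before it, as seen
  from part \<open>x\<close>, the blocks at the vertex \<open>i\<close> of part \<open>x\<close> follow each other without gap or overlap and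
  fill an interval that starts at \<open>i\<close>.

  The color must be the same from both ends of an edge: parts \<open>x\<close> and \<open>xor x z\<close> have to agree on
  the shift of block \<open>z\<close>. This is where the alternation of \<open>s\<close> and \<open>t\<close> enters
  (\<open>block_offset_alternating\<close>). If \<open>z\<close> is even, both parts have the same parity and see the same
  sizes in the same order. If \<open>z\<close> is odd, the blocks \<open>1, \<dots>, z - 1\<close> come in pairs of total size \<open>s + t\<close>
  from either side.
\<close>

section \<open>Edge colorings given on ordered pairs\<close>

lemma interval_colorableI:
  fixes G :: "('a, 'b) pre_digraph" and col :: "'a \<Rightarrow> 'a \<Rightarrow> nat"
  assumes "graph G"
    and sym: "\<And>u v. (u, v) \<in> arcs_ends G \<Longrightarrow> col u v = col v u"
    and inj: "\<And>v. v \<in> verts G \<Longrightarrow> inj_on (col v) {u. (v, u) \<in> arcs_ends G}"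
    and img: "\<And>v. v \<in> verts G \<Longrightarrow> \<exists>a b. col v ` {u. (v, u) \<in> arcs_ends G} = {a..<b}"
  shows "interval_colorable G"
proof -
  interpret graph G by fact
  have arc_sym: "(v, u) \<in> arcs_ends G" if "(u, v) \<in> arcs_ends G" for u v
    using that sym_arcs by (auto simp: symmetric_def dest: symD)
  define c where "c e = (SOME k. \<exists>u v. (u, v) \<in> arcs_ends G \<and> e = {u, v} \<and> k = col u v)" for e
  have c: "c {u, v} = col u v" if "(u, v) \<in> arcs_ends G" for u v
  proof -
    have "k = col u v" if "\<exists>u' v'. (u', v') \<in> arcs_ends G \<and> {u, v} = {u', v'} \<and> k = col u' v'" for k
      using that sym by (auto simp: doubleton_eq_iff)
    then show ?thesis
      unfolding c_def using that by (intro some_equality) blast+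
  qed
  have inc: "incident_edges G v = (\<lambda>u. {v, u}) ` {u. (v, u) \<in> arcs_ends G}" for v
    by (auto simp: incident_edges_def edges_def insert_commute dest: arc_sym)
  have "proper_edge_coloring G c"
    unfolding proper_edge_coloring_def
  proof (intro ballI impI, elim conjE)
    fix e f assume ef: "e \<in> edges G" "f \<in> edges G" "e \<noteq> f" "e \<inter> f \<noteq> {}"
    then obtain v where "v \<in> e" "v \<in> f" by blast
    with ef have "e \<in> incident_edges G v" "f \<in> incident_edges G v"
      by (auto simp: incident_edges_def)
    then obtain u w where uw: "(v, u) \<in> arcs_ends G" "e = {v, u}" "(v, w) \<in> arcs_ends G" "f = {v, w}"
      unfolding inc by blast
    with ef have "u \<noteq> w" by blast
    moreover have "v \<in> verts G" using uw(1) by (rule adj_in_verts)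
    ultimately show "c e \<noteq> c f"
      using inj_onD[OF inj, of v u w] uw by (auto simp: c)
  qed
  moreover have "\<exists>a b. c ` incident_edges G v = {a..b}" if v: "v \<in> verts G" for v
  proof -
    obtain a b where ab: "col v ` {u. (v, u) \<in> arcs_ends G} = {a..<b}" using img[OF v] by blast
    have "c ` incident_edges G v = {a..<b}"
      unfolding inc ab[symmetric] image_image by (intro image_cong) (auto simp: c)
    (* On the naturals, {a..<b} differs from {a..b - 1} when a = b = 0. *)
    also have "\<exists>a' b'. {a..<b} = {a'..b'}"
    proof (cases b)
      case 0
      then have "{a..<b} = {1..0}" by auto
      then show ?thesis by blast
    next
      case (Suc b')
      then have "{a..<b} = {a..b'}" by auto
      then show ?thesis by blast
    qed
    finally show ?thesis .
  qed
  ultimately show ?thesis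
    unfolding interval_colorable_def interval_coloring_def by blast
qed

section \<open>Coordinates on a complete multipartite graph\<close>

lemma complete_multipartite_coordinates:
  fixes G :: "('a, 'b) pre_digraph"
  assumes "complete_multipartite ns G"
  obtains part pos :: "'a \<Rightarrow> nat"
  where "bij_betw (\<lambda>v. (part v, pos v)) (verts G) (SIGMA x:{..<length ns}. {..<ns ! x})"
    and "\<And>u v. u \<in> verts G \<Longrightarrow> v \<in> verts G \<Longrightarrow> (u, v) \<in> arcs_ends G \<longleftrightarrow> part u \<noteq> part v"
proof -
  obtain Ps where gr: "graph G" and dist: "distinct Ps" and mp: "multipartite_parts G (set Ps)"
    and cards: "map card Ps = ns"
    using assms unfolding complete_multipartite_def by blast
  interpret graph G by fact
  have len: "length Ps = length ns" using cards by auto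
  have card: "card (Ps ! x) = ns ! x" if "x < length ns" for x
    using cards that by auto
  have un: "\<Union>(set Ps) = verts G" and dj: "disjoint (set Ps)"
    and adj: "\<And>A B u v. A \<in> set Ps \<Longrightarrow> B \<in> set Ps \<Longrightarrow> u \<in> A \<Longrightarrow> v \<in> B \<Longrightarrow>
      (u, v) \<in> arcs_ends G \<longleftrightarrow> A \<noteq> B"
    using mp by (auto simp: multipartite_parts_def partition_on_def)
  have "\<exists>h. bij_betw h (Ps ! x) {..<ns ! x}" if "x < length ns" for x
  proof -
    have "finite (Ps ! x)"
      using un that len by (metis Sup_upper finite_subset finite_verts nth_mem)
    then show ?thesis
      using ex_bij_betw_finite_nat[of "Ps ! x"] card[OF that] by (simp add: atLeast0LessThan)
  qed
  then obtain h where h: "bij_betw (h x) (Ps ! x) {..<ns ! x}" if "x < length ns" for x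
    by metis
  have uniq: "x = y" if "x < length ns" "y < length ns" "v \<in> Ps ! x" "v \<in> Ps ! y" for x y v
    using dist dj that len by (metis disjoint_iff disjointD nth_eq_iff_index_eq nth_mem)
  have "\<exists>x<length ns. v \<in> Ps ! x" if "v \<in> verts G" for v
    using that un len by (metis Union_iff in_set_conv_nth)
  then obtain part where part: "part v < length ns" "v \<in> Ps ! part v" if "v \<in> verts G" for v
    by metis
  have part_eq: "part v = x" if "x < length ns" "v \<in> Ps ! x" for x v
  proof -
    have "v \<in> verts G" using un that len by (metis UnionI nth_mem)
    then show ?thesis using part uniq that by blast
  qed
  define pos where "pos v = h (part v) v" for v
  show thesis
  proof (rule that[of part pos])
    show "bij_betw (\<lambda>v. (part v, pos v)) (verts G) (SIGMA x:{..<length ns}. {..<ns ! x})"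
      unfolding bij_betw_def
    proof
      show "inj_on (\<lambda>v. (part v, pos v)) (verts G)"
      proof (rule inj_onI)
        fix u v assume uv: "u \<in> verts G" "v \<in> verts G" "(part u, pos u) = (part v, pos v)"
        then show "u = v"
          using bij_betw_imp_inj_on[OF h, of "part u"] part[of u] part[of v]
          by (auto simp: pos_def dest: inj_onD)
      qed
      show "(\<lambda>v. (part v, pos v)) ` verts G = (SIGMA x:{..<length ns}. {..<ns ! x})"
      proof (intro equalityI subsetI)
        fix q assume "q \<in> (\<lambda>v. (part v, pos v)) ` verts G"
        then show "q \<in> (SIGMA x:{..<length ns}. {..<ns ! x})"
          using part bij_betw_apply[OF h] by (auto simp: pos_def)
      next
        fix q assume "q \<in> (SIGMA x:{..<length ns}. {..<ns ! x})"
        then obtain x i where q: "q = (x, i)" "x < length ns" "i < ns ! x" by auto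
        then have "i \<in> h x ` (Ps ! x)" using bij_betw_imp_surj_on[OF h] by blast
        then obtain v where v: "v \<in> Ps ! x" "h x v = i" by blast
        then have "v \<in> verts G" using un q(2) len by (metis UnionI nth_mem)
        with v q part_eq[OF q(2) v(1)] show "q \<in> (\<lambda>v. (part v, pos v)) ` verts G"
          by (auto simp: pos_def)
      qed
    qed
  next
    fix u v assume uv: "u \<in> verts G" "v \<in> verts G"
    then have "(u, v) \<in> arcs_ends G \<longleftrightarrow> Ps ! part u \<noteq> Ps ! part v"
      using part len by (intro adj) auto
    also have "\<dots> \<longleftrightarrow> part u \<noteq> part v"
      using part[OF uv(1)] part[OF uv(2)] dist len by (simp add: nth_eq_iff_index_eq)
    finally show "(u, v) \<in> arcs_ends G \<longleftrightarrow> part u \<noteq> part v" .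
  qed
qed

section \<open>Stacking the blocks\<close>

text \<open>
  The shift of block \<open>z\<close> at part \<open>x\<close>, when part \<open>y\<close> has size \<open>f y\<close>. The sum starts at \<open>1\<close> because
  block \<open>0\<close> would join part \<open>x\<close> to itself.
\<close>

definition block_offset :: "(nat \<Rightarrow> nat) \<Rightarrow> nat \<Rightarrow> nat \<Rightarrow> nat" where
  "block_offset f x z = (\<Sum>w = 1..<z. f (xor x w))"

lemma block_offset_Suc:
  "1 \<le> z \<Longrightarrow> block_offset f x (Suc z) = block_offset f x z + f (xor x z)"
  by (simp add: block_offset_def)

lemma block_offset_mono: "y \<le> z \<Longrightarrow> block_offset f x y \<le> block_offset f x z"
  unfolding block_offset_def by (rule sum_mono2) auto

lemma block_unique:
  assumes "block_offset f x y \<le> k" "k < block_offset f x (Suc y)"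
    and "block_offset f x z \<le> k" "k < block_offset f x (Suc z)"
  shows "y = z"
proof (cases y z rule: linorder_cases)
  case less
  then show ?thesis using assms block_offset_mono[of "Suc y" z f x] by linarith
next
  case greater
  then show ?thesis using assms block_offset_mono[of "Suc z" y f x] by linarith
qed

lemma block_exists:
  "k < block_offset f x n \<Longrightarrow>
    \<exists>z. 1 \<le> z \<and> z < n \<and> block_offset f x z \<le> k \<and> k < block_offset f x (Suc z)"
proof (induction n)
  case 0
  then show ?case by (simp add: block_offset_def)
next
  case (Suc n)
  show ?case
  proof (cases "k < block_offset f x n")
    case True
    then show ?thesis using Suc.IH less_SucI by blast
  next
    case False
    moreover have "n \<noteq> 0" using Suc.prems by (intro notI) (simp add: block_offset_def)
    ultimately show ?thesis using Suc.prems by (intro exI[of _ n]) simp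
  qed
qed

lemma xor_less_power_of_2:
  fixes x y :: nat
  assumes "x < 2 ^ l" "y < 2 ^ l"
  shows "xor x y < 2 ^ l"
proof -
  have "take_bit l (xor x y) = xor x y"
    using assms by (simp add: take_bit_xor take_bit_nat_eq_self)
  then show ?thesis by (simp only: take_bit_nat_eq_self_iff)
qed

lemma xor_xor_cancel: "xor x (xor x y) = y" for x y :: nat
  by (simp only: xor.assoc[symmetric] xor_self_eq xor.left_neutral)

text \<open>
  Agreement of the shifts makes the coloring symmetric, hence a coloring of undirected edges. The
  rest is the decomposition of \<open>k - pos v\<close> for a color \<open>k\<close> at a vertex \<open>v\<close>: the block that
  contains it determines the part of the other endpoint, and the remainder determines the position
  in that part.
\<close>

lemma interval_colorable_if_offsets_agree:
  fixes G :: "('a, 'b) pre_digraph" and f :: "nat \<Rightarrow> nat"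
  assumes cm: "complete_multipartite (map f [0..<2 ^ l]) G"
    and agree: "\<And>x y. block_offset f x (xor x y) = block_offset f y (xor x y)"
  shows "interval_colorable G"
proof -
  interpret graph G using cm by (simp add: complete_multipartite_def)
  have sig: "(SIGMA x:{..<length (map f [0..<2 ^ l])}. {..<map f [0..<2 ^ l] ! x}) =
      (SIGMA x:{..<2 ^ l}. {..<f x})"
    by auto
  obtain part pos :: "'a \<Rightarrow> nat"
    where bij: "bij_betw (\<lambda>v. (part v, pos v)) (verts G) (SIGMA x:{..<2 ^ l}. {..<f x})"
      and adj: "\<And>u v. u \<in> verts G \<Longrightarrow> v \<in> verts G \<Longrightarrow> (u, v) \<in> arcs_ends G \<longleftrightarrow> part u \<noteq> part v"
    using complete_multipartite_coordinates[OF cm] unfolding sig by blast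
  have bounds: "part v < 2 ^ l" "pos v < f (part v)" if "v \<in> verts G" for v
    using bij_betw_apply[OF bij that] by auto
  define col where
    "col v u = pos v + pos u + block_offset f (part v) (xor (part v) (part u))" for v u
  define N where "N v = {u. (v, u) \<in> arcs_ends G}" for v
  have N: "N v = {u \<in> verts G. part u \<noteq> part v}" if "v \<in> verts G" for v
  proof -
    have "u \<in> verts G" if "(v, u) \<in> arcs_ends G" for u
      using that by (rule adj_in_verts)
    then show ?thesis unfolding N_def using adj[OF that] by (intro Collect_cong) metis
  qed
  (* The color seen from v, relative to pos v, lies in the block of the part of u. *)
  have block: "block_offset f (part v) z \<le> col v u - pos v"
      "col v u - pos v < block_offset f (part v) (Suc z)" "1 \<le> z" "z < 2 ^ l"
    if "v \<in> verts G" "u \<in> N v" and z: "z = xor (part v) (part u)" for u v z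
  proof -
    have u: "u \<in> verts G" "part u \<noteq> part v" using that N by auto
    have "z \<noteq> 0"
    proof
      assume "z = 0"
      then have "xor (part v) z = part v" by simp
      then show False using u(2) by (simp add: z xor_xor_cancel)
    qed
    then show "1 \<le> z" by simp
    then show "col v u - pos v < block_offset f (part v) (Suc z)"
      using bounds(2)[OF u(1)] by (simp add: block_offset_Suc col_def z xor_xor_cancel)
    show "block_offset f (part v) z \<le> col v u - pos v" by (simp add: col_def z)
    show "z < 2 ^ l" using z bounds(1) that(1) u(1) by (simp add: xor_less_power_of_2)
  qed
  show ?thesis
  proof (rule interval_colorableI)
    show "graph G" by (rule graph_axioms)
    show "col u v = col v u" for u v
      using agree[of "part u" "part v"] by (simp add: col_def xor.commute)
  next
    fix v assume v: "v \<in> verts G"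
    show "inj_on (col v) {u. (v, u) \<in> arcs_ends G}"
      unfolding N_def[symmetric]
    proof (rule inj_onI)
      fix u w assume uw: "u \<in> N v" "w \<in> N v" "col v u = col v w"
      define z z' where "z = xor (part v) (part u)" and "z' = xor (part v) (part w)"
      note block_u = block(1,2)[OF v uw(1) z_def]
      have block_w: "block_offset f (part v) z' \<le> col v u - pos v"
        "col v u - pos v < block_offset f (part v) (Suc z')"
        unfolding uw(3) by (fact block(1,2)[OF v uw(2) z'_def])+
      have "z = z'" using block_u block_w by (rule block_unique)
      then have "part u = part w"
        unfolding z_def z'_def by (metis xor_xor_cancel)
      moreover from this uw(3) have "pos u = pos w" by (simp add: col_def)
      moreover have "u \<in> verts G" "w \<in> verts G" using uw(1,2) N[OF v] by blast+
      ultimately show "u = w"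
        by (intro inj_onD[OF bij_betw_imp_inj_on[OF bij]]) simp_all
    qed
    have "col v ` N v = {pos v..<pos v + block_offset f (part v) (2 ^ l)}"
    proof (intro equalityI subsetI)
      fix k assume "k \<in> col v ` N v"
      then obtain u where u: "u \<in> N v" "k = col v u" by blast
      define z where "z = xor (part v) (part u)"
      note block = block[OF v u(1) z_def]
      have "pos v \<le> k" by (simp add: u(2) col_def)
      moreover have "k - pos v < block_offset f (part v) (2 ^ l)"
        using block(2,4) block_offset_mono[of "Suc z" "2 ^ l" f "part v"] by (simp add: u(2))
      ultimately show "k \<in> {pos v..<pos v + block_offset f (part v) (2 ^ l)}" by auto
    next
      fix k assume k: "k \<in> {pos v..<pos v + block_offset f (part v) (2 ^ l)}"
      then have "k - pos v < block_offset f (part v) (2 ^ l)" by auto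
      then obtain z where z: "1 \<le> z" "z < 2 ^ l" "block_offset f (part v) z \<le> k - pos v"
        "k - pos v < block_offset f (part v) (Suc z)"
        using block_exists[of "k - pos v" f "part v" "2 ^ l"] by blast
      define y where "y = xor (part v) z"
      define j where "j = k - pos v - block_offset f (part v) z"
      have "j < f y"
        using z block_offset_Suc[OF z(1), of f "part v"] unfolding j_def y_def by linarith
      moreover have "y < 2 ^ l" using z bounds(1)[OF v] by (simp add: y_def xor_less_power_of_2)
      ultimately have "(y, j) \<in> (\<lambda>v. (part v, pos v)) ` verts G"
        unfolding bij_betw_imp_surj_on[OF bij] by simp
      then obtain u where u: "u \<in> verts G" "part u = y" "pos u = j" by auto
      have "y \<noteq> part v"
      proof
        assume "y = part v"
        then have "z = xor (part v) (part v)" by (metis y_def xor_xor_cancel)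
        then show False using z(1) by simp
      qed
      then have "u \<in> N v" using u by (simp add: N[OF v])
      have "xor (part v) (part u) = z" unfolding u(2) y_def by (rule xor_xor_cancel)
      then have "col v u = pos v + j + block_offset f (part v) z" by (simp only: col_def u(3))
      moreover have "pos v \<le> k" using k by simp
      ultimately have "col v u = k" using z(3) unfolding j_def by linarith
      then show "k \<in> col v ` N v" using \<open>u \<in> N v\<close> by blast
    qed
    then show "\<exists>a b. col v ` {u. (v, u) \<in> arcs_ends G} = {a..<b}"
      unfolding N_def by blast
  qed
qed

section \<open>Alternating part sizes\<close>

lemma block_offset_alternating_odd:
  "block_offset (\<lambda>i. if even i then s else t) x (2 * k + 1) = k * (s + t)"
proof (induction k)
  case 0
  show ?case by (simp add: block_offset_def)
next
  case (Suc k)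
  have "block_offset (\<lambda>i. if even i then s else t) x (2 * Suc k + 1) =
      block_offset (\<lambda>i. if even i then s else t) x (2 * k + 1) + (s + t)"
    by (simp add: block_offset_def even_xor_iff)
  also have "\<dots> = Suc k * (s + t)" unfolding Suc.IH by simp
  finally show ?case .
qed

lemma block_offset_alternating:
  fixes x y s t :: nat
  defines "f \<equiv> \<lambda>i::nat. if even i then s else t"
  shows "block_offset f x (xor x y) = block_offset f y (xor x y)"
proof (cases "even (xor x y)")
  case True
  then have "even x \<longleftrightarrow> even y" by (simp add: even_xor_iff)
  then have "f (xor x w) = f (xor y w)" for w by (simp add: f_def even_xor_iff)
  then show ?thesis by (simp only: block_offset_def)
next
  case False
  then obtain k where "xor x y = 2 * k + 1" by (rule oddE)
  then show ?thesis unfolding f_def by (simp only: block_offset_alternating_odd)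
qed

theorem theorem11:
  fixes G :: "('a, 'b) pre_digraph" and s t l m :: nat
  assumes "s \<ge> 1" and "t \<ge> 1" and "l \<ge> 1" and "m = 2 ^ l"
    and "complete_multipartite (map (\<lambda>i. if even i then s else t) [0..<m]) G"
  shows "interval_colorable G"
  using assms(5) unfolding \<open>m = 2 ^ l\<close>
  by (rule interval_colorable_if_offsets_agree) (rule block_offset_alternating)

end
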